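(* For integers $k\ge1$ and $N\ge k+1$, $$W_2(N,k)=\theta\,T_2(N,k)-\theta^{2N-2k+1}(P_{N-2})!\,P_kP_{k-1}$$ $$=\theta\,(P_k)!\Big\{(1+\theta^2P_{N-2})(1+\theta^2P_{N-3})\cdots(1+\theta^2P_k)(1+\theta^2P_{k-1})-\theta^{2N-2k}P_{N-2}P_{N-3}\cdots P_{k-1}\Big\}.$$
   Context: Let $\theta>0$. $\mathrm{inv}(\pi)$ is the number of pairs $i<j$ with $\pi_i>\pi_j$. $P_n=1+\theta+\cdots+\theta^{n-1}$ ($P_0=0$), $(P_n)!=P_n\cdots P_1$, $(P_0)!=1$. For $\pi\in S_n$, position $i$ is a left-to-right second maximum if exactly one $j<i$ has $\pi_j>\pi_i$. The strategy $S^2_k$ rejects the first $k$ candidates and then accepts the first subsequent left-to-right second maximum (if any). $\pi\in S_n$ is $k$-pickable if $S^2_k$ selects some position, and $k$-winnable if $S^2_k$ selects a position holding value $n-1$. $T_2(n,k)=\sum_{\pi\in S_n\text{ not }k\text{-pickable}}\theta^{\mathrm{inv}(\pi)}$ and $W_2(n,k)=\sum_{\pi\in S_n\ k\text{-winnable}}\theta^{\mathrm{inv}(\pi)}$. *)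

theory Defs
  imports Complex_Main "HOL-Combinatorics.Permutations"
begin

text \<open>A permutation in \<open>S\<^sub>n\<close> is a function \<open>\<pi>\<close> with \<open>\<pi> permutes {1..n}\<close>; \<open>\<pi> i\<close> is the
  value at position \<open>i\<close> (the larger, the better the candidate).\<close>

definition inv_count :: "nat \<Rightarrow> (nat \<Rightarrow> nat) \<Rightarrow> nat" where
  "inv_count n \<pi> = card {(i, j). i \<in> {1..n} \<and> j \<in> {1..n} \<and> i < j \<and> \<pi> i > \<pi> j}"

definition P :: "real \<Rightarrow> nat \<Rightarrow> real" where
  "P \<theta> n = (\<Sum>i<n. \<theta> ^ i)"

definition P_fact :: "real \<Rightarrow> nat \<Rightarrow> real" where
  "P_fact \<theta> n = (\<Prod>i=1..n. P \<theta> i)"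

definition second_max :: "(nat \<Rightarrow> nat) \<Rightarrow> nat \<Rightarrow> bool" where
  "second_max \<pi> i \<longleftrightarrow> card {j. 1 \<le> j \<and> j < i \<and> \<pi> j > \<pi> i} = 1"

text \<open>The position selected by the strategy \<open>S\<^sup>2\<^sub>k\<close>, if any.\<close>

definition S2 :: "nat \<Rightarrow> nat \<Rightarrow> (nat \<Rightarrow> nat) \<Rightarrow> nat option" where
  "S2 n k \<pi> =
     (if \<exists>i. k < i \<and> i \<le> n \<and> second_max \<pi> i
      then Some (LEAST i. k < i \<and> i \<le> n \<and> second_max \<pi> i)
      else None)"

definition pickable :: "nat \<Rightarrow> nat \<Rightarrow> (nat \<Rightarrow> nat) \<Rightarrow> bool" where
  "pickable n k \<pi> \<longleftrightarrow> (\<exists>i. S2 n k \<pi> = Some i)"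

definition winnable :: "nat \<Rightarrow> nat \<Rightarrow> (nat \<Rightarrow> nat) \<Rightarrow> bool" where
  "winnable n k \<pi> \<longleftrightarrow> (\<exists>i. S2 n k \<pi> = Some i \<and> \<pi> i = n - 1)"

definition T2 :: "real \<Rightarrow> nat \<Rightarrow> nat \<Rightarrow> real" where
  "T2 \<theta> n k = (\<Sum>\<pi> | \<pi> permutes {1..n} \<and> \<not> pickable n k \<pi>. \<theta> ^ inv_count n \<pi>)"

definition W2 :: "real \<Rightarrow> nat \<Rightarrow> nat \<Rightarrow> real" where
  "W2 \<theta> n k = (\<Sum>\<pi> | \<pi> permutes {1..n} \<and> winnable n k \<pi>. \<theta> ^ inv_count n \<pi>)"

end

theory Submission
  imports Defs "HOL-Library.FuncSet"
begin

text \<open>The code of \<open>\<pi>\<close> at \<open>i\<close> counts the \<open>j < i\<close> with \<open>\<pi> j > \<pi> i\<close>. The codes sum to the number of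
  inversions and identify \<open>S\<^sub>n\<close> with the box of sequences satisfying \<open>c\<^sub>i < i\<close>, so that weighted
  counts of permutations defined by independent conditions on the codes factor. Position \<open>i\<close> is a
  second maximum iff its code is \<open>1\<close>, and a second maximum at \<open>i\<close> holds \<open>n - 1\<close> iff all later codes
  are at least \<open>2\<close>. Hence \<open>T\<^sub>2\<close> is a product of factors \<open>x\<^sub>j = 1 + \<theta>\<^sup>2 P\<^sub>j\<^sub>-\<^sub>2\<close>, whereas \<open>W\<^sub>2\<close> is a sum
  over the selected position of products of factors \<open>x\<^sub>j\<close> before it and \<open>y\<^sub>j = \<theta>\<^sup>2 P\<^sub>j\<^sub>-\<^sub>2\<close> after it;
  since \<open>x\<^sub>j - y\<^sub>j = 1\<close>, this sum telescopes.\<close>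

section \<open>Inversions counted by codes\<close>

definition lehmer :: "(nat \<Rightarrow> nat) \<Rightarrow> nat \<Rightarrow> nat" where
  "lehmer \<pi> i = card {j. 1 \<le> j \<and> j < i \<and> \<pi> j > \<pi> i}"

lemma second_max_iff_lehmer: "second_max \<pi> i \<longleftrightarrow> lehmer \<pi> i = 1"
  by (simp add: second_max_def lehmer_def)

lemma lehmer_less:
  assumes "1 \<le> i"
  shows "lehmer \<pi> i < i"
proof -
  have "lehmer \<pi> i \<le> card {1..<i}"
    unfolding lehmer_def by (rule card_mono) auto
  with assms show ?thesis by simp
qed

lemma inv_count_eq_sum_lehmer: "inv_count n \<pi> = (\<Sum>i=1..n. lehmer \<pi> i)"
proof -
  let ?J = "\<lambda>i. {j. 1 \<le> j \<and> j < i \<and> \<pi> j > \<pi> i}"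
  \<comment> \<open>A code counts the inversions with a given right-hand position, so the pairs are
    swapped to bring that position first.\<close>
  have "{(i, j). i \<in> {1..n} \<and> j \<in> {1..n} \<and> i < j \<and> \<pi> i > \<pi> j}
      = prod.swap ` (SIGMA i:{1..n}. ?J i)"
    by (auto simp: image_iff)
  then have "inv_count n \<pi> = card (SIGMA i:{1..n}. ?J i)"
    unfolding inv_count_def by (simp add: card_image)
  also have "\<dots> = (\<Sum>i=1..n. lehmer \<pi> i)"
    unfolding lehmer_def by (rule card_SigmaI) (auto intro: finite_subset[of _ "{..<i}" for i])
  finally show ?thesis .
qed

section \<open>Recovering a permutation from its code\<close>

lemma inj_on_card_greater:
  fixes R :: "'a::linorder set"
  assumes "finite R"
  shows "inj_on (\<lambda>v. card {u \<in> R. u > v}) R"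
proof (rule linorder_inj_onI')
  fix v w assume vw: "v \<in> R" "w \<in> R" "v < w"
  then have "{u \<in> R. u > w} \<subset> {u \<in> R. u > v}" by auto
  with assms have "card {u \<in> R. u > w} < card {u \<in> R. u > v}"
    by (intro psubset_card_mono) auto
  then show "card {u \<in> R. u > v} \<noteq> card {u \<in> R. u > w}" by simp
qed

text \<open>The values at positions up to \<open>i\<close> are exactly those not taken after
  \<open>i\<close>. So once the later entries are known, the code gives the rank of
  \<open>\<pi> i\<close>, from the top, among the values still available.\<close>

lemma lehmer_eq_card_values:
  assumes "\<pi> permutes {1..n}" "i \<in> {1..n}"
  shows "lehmer \<pi> i = card {u \<in> {1..n} - \<pi> ` {i<..n}. u > \<pi> i}"
proof -
  have inj: "inj \<pi>" using assms(1) by (rule permutes_inj)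
  have "{1..n} - \<pi> ` {i<..n} = \<pi> ` ({1..n} - {i<..n})"
    using image_set_diff[OF inj, of "{1..n}" "{i<..n}"] permutes_image[OF assms(1)] by simp
  also have "{1..n} - {i<..n} = {1..i}" using assms(2) by auto
  finally have "{u \<in> {1..n} - \<pi> ` {i<..n}. u > \<pi> i} = \<pi> ` {j. 1 \<le> j \<and> j < i \<and> \<pi> j > \<pi> i}"
    by (auto simp: image_iff) (metis le_neq_implies_less less_irrefl)
  then show ?thesis
    unfolding lehmer_def using inj by (simp add: card_image inj_on_subset)
qed

text \<open>Decoding runs from right to left: the entries after \<open>i\<close> fix the set
  \<open>R\<close> of available values, and the code at \<open>i\<close> then singles out one
  element of \<open>R\<close>.\<close>

lemma lehmer_inj:
  assumes "\<pi> permutes {1..n}" "\<sigma> permutes {1..n}"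
    and eq: "\<And>i. i \<in> {1..n} \<Longrightarrow> lehmer \<pi> i = lehmer \<sigma> i"
  shows "\<pi> = \<sigma>"
proof -
  have step: "i \<in> {1..n} \<Longrightarrow> \<pi> i = \<sigma> i" for i
  proof (induction "n - i" arbitrary: i rule: less_induct)
    case less
    define R where "R = {1..n} - \<pi> ` {i<..n}"
    \<comment> \<open>Positions beyond \<open>i\<close> have a smaller \<open>n - i\<close>, so the
      induction hypothesis covers all of them.\<close>
    have "\<pi> ` {i<..n} = \<sigma> ` {i<..n}"
      using less.hyps less.prems by (intro image_cong) auto
    then have R': "R = {1..n} - \<sigma> ` {i<..n}" by (simp add: R_def)
    have mem: "\<tau> i \<in> {1..n} - \<tau> ` {i<..n}" if "\<tau> permutes {1..n}" for \<tau>
      using less.prems permutes_in_image[OF that, of i]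
      by (simp add: inj_image_mem_iff[OF permutes_inj[OF that]])
    have "\<pi> i \<in> R" "\<sigma> i \<in> R"
      using mem[OF assms(1)] mem[OF assms(2)] by (simp_all only: R_def[symmetric] R'[symmetric])
    moreover have "card {u \<in> R. u > \<pi> i} = card {u \<in> R. u > \<sigma> i}"
      using lehmer_eq_card_values[OF assms(1) less.prems]
        lehmer_eq_card_values[OF assms(2) less.prems] eq[OF less.prems]
      by (simp only: R_def[symmetric] R'[symmetric])
    ultimately show ?case
      using inj_on_card_greater[of R] by (auto simp: R_def dest: inj_onD)
  qed
  show ?thesis
  proof
    fix i show "\<pi> i = \<sigma> i"
      using step[of i] assms(1,2) by (cases "i \<in> {1..n}") (auto simp: permutes_def)
  qed
qed

text \<open>Surjectivity comes from counting: the map is injective, and both sides have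
  \<open>n!\<close> elements.\<close>

lemma lehmer_bij_betw:
  "bij_betw (\<lambda>\<pi>. restrict (lehmer \<pi>) {1..n}) {\<pi>. \<pi> permutes {1..n}} (PiE {1..n} (\<lambda>i. {..<i}))"
proof -
  let ?f = "\<lambda>\<pi>. restrict (lehmer \<pi>) {1..n}"
  let ?S = "{\<pi>. \<pi> permutes {1..n}}" and ?B = "PiE {1..n} (\<lambda>i::nat. {..<i})"
  have inj: "inj_on ?f ?S"
  proof (rule inj_onI)
    fix \<pi> \<sigma> assume *: "\<pi> \<in> ?S" "\<sigma> \<in> ?S" "?f \<pi> = ?f \<sigma>"
    have "lehmer \<pi> i = lehmer \<sigma> i" if "i \<in> {1..n}" for i
      using fun_cong[OF *(3), of i] that by simp
    with *(1,2) show "\<pi> = \<sigma>" by (intro lehmer_inj) auto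
  qed
  have sub: "?f ` ?S \<subseteq> ?B"
    by (auto intro!: lehmer_less)
  have "card (?f ` ?S) = card ?B"
    using card_image[OF inj] card_permutations[of "{1..n}" n]
    by (simp add: card_PiE fact_prod)
  then have "?f ` ?S = ?B"
    using sub by (intro card_subset_eq) (auto intro: finite_PiE)
  with inj show ?thesis by (simp add: bij_betw_def)
qed

section \<open>Factorisation of weighted counts\<close>

lemma sum_inv_count_lehmer_in:
  fixes \<theta> :: real
  shows "(\<Sum>\<pi> | \<pi> permutes {1..n} \<and> (\<forall>i\<in>{1..n}. lehmer \<pi> i \<in> A i). \<theta> ^ inv_count n \<pi>)
       = (\<Prod>i=1..n. \<Sum>a\<in>A i \<inter> {..<i}. \<theta> ^ a)"
proof -
  let ?f = "\<lambda>\<pi>. restrict (lehmer \<pi>) {1..n}"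
  let ?S = "{\<pi>. \<pi> permutes {1..n} \<and> (\<forall>i\<in>{1..n}. lehmer \<pi> i \<in> A i)}"
  let ?B = "PiE {1..n} (\<lambda>i. A i \<inter> {..<i})"
  have "?f ` ?S = ?B"
  proof
    show "?f ` ?S \<subseteq> ?B" by (auto intro!: lehmer_less)
    show "?B \<subseteq> ?f ` ?S"
    proof
      fix c assume c: "c \<in> ?B"
      \<comment> \<open>The smaller box lies in the full one, so \<open>c\<close> is the code of
        some permutation, which then satisfies the conditions \<open>A\<close>.\<close>
      then have "c \<in> PiE {1..n} (\<lambda>i. {..<i})" by (auto simp: PiE_iff)
      then obtain \<pi> where \<pi>: "\<pi> permutes {1..n}" "c = ?f \<pi>"
        using lehmer_bij_betw[of n] unfolding bij_betw_def by blast
      moreover have "\<forall>i\<in>{1..n}. lehmer \<pi> i \<in> A i"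
        using c \<pi>(2) by (auto simp: PiE_iff)
      ultimately show "c \<in> ?f ` ?S" by blast
    qed
  qed
  moreover have "inj_on ?f ?S"
    using lehmer_bij_betw[of n] unfolding bij_betw_def by (auto elim: inj_on_subset)
  ultimately have "bij_betw ?f ?S ?B" by (simp add: bij_betw_def)
  then have "(\<Sum>\<pi>\<in>?S. \<Prod>i=1..n. \<theta> ^ ?f \<pi> i) = (\<Sum>c\<in>?B. \<Prod>i=1..n. \<theta> ^ c i)"
    by (rule sum.reindex_bij_betw)
  also have "(\<Sum>\<pi>\<in>?S. \<Prod>i=1..n. \<theta> ^ ?f \<pi> i) = (\<Sum>\<pi>\<in>?S. \<theta> ^ inv_count n \<pi>)"
    by (intro sum.cong) (auto simp: inv_count_eq_sum_lehmer power_sum)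
  also have "(\<Sum>c\<in>?B. \<Prod>i=1..n. \<theta> ^ c i) = (\<Prod>i=1..n. \<Sum>a\<in>A i \<inter> {..<i}. \<theta> ^ a)"
    by (rule prod_sum_PiE[symmetric]) auto
  finally show ?thesis .
qed

lemma sum_power_ge2:
  assumes "2 \<le> j"
  shows "(\<Sum>a\<in>{2..} \<inter> {..<j}. \<theta> ^ a) = \<theta>\<^sup>2 * P \<theta> (j - 2)"
proof -
  have "{2..} \<inter> {..<j} = {0 + 2..<j - 2 + 2}" using assms by auto
  then show ?thesis
    by (simp only: sum.shift_bounds_nat_ivl P_def sum_distrib_left power_add mult.commute
        lessThan_atLeast0)
qed

lemma sum_power_neq1:
  assumes "2 \<le> j"
  shows "(\<Sum>a\<in>-{1} \<inter> {..<j}. \<theta> ^ a) = 1 + \<theta>\<^sup>2 * P \<theta> (j - 2)"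
proof -
  have "-{1} \<inter> {..<j} = insert 0 ({2..} \<inter> {..<j})" using assms by auto
  then show ?thesis using sum_power_ge2[OF assms, of \<theta>] by simp
qed

section \<open>The strategy in terms of codes\<close>

lemma pickable_iff_lehmer: "pickable n k \<pi> \<longleftrightarrow> (\<exists>i\<in>{k<..n}. lehmer \<pi> i = 1)"
  by (auto simp: pickable_def S2_def second_max_iff_lehmer)

lemma S2_eq_Some_iff:
  "S2 n k \<pi> = Some i \<longleftrightarrow>
    i \<in> {k<..n} \<and> lehmer \<pi> i = 1 \<and> (\<forall>j\<in>{k<..<i}. lehmer \<pi> j \<noteq> 1)"
proof
  let ?Q = "\<lambda>i. k < i \<and> i \<le> n \<and> lehmer \<pi> i = 1"
  assume "S2 n k \<pi> = Some i"
  then have ex: "\<exists>i. ?Q i" and i: "i = (LEAST i. ?Q i)"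
    by (auto simp: S2_def second_max_iff_lehmer split: if_splits)
  from ex have Qi: "?Q i" unfolding i by (rule LeastI_ex)
  moreover have "lehmer \<pi> j \<noteq> 1" if "j \<in> {k<..<i}" for j
    using not_less_Least[of j ?Q] that Qi unfolding i[symmetric] by auto
  ultimately show "i \<in> {k<..n} \<and> lehmer \<pi> i = 1 \<and> (\<forall>j\<in>{k<..<i}. lehmer \<pi> j \<noteq> 1)"
    by auto
next
  let ?Q = "\<lambda>i. k < i \<and> i \<le> n \<and> lehmer \<pi> i = 1"
  assume *: "i \<in> {k<..n} \<and> lehmer \<pi> i = 1 \<and> (\<forall>j\<in>{k<..<i}. lehmer \<pi> j \<noteq> 1)"
  then have "(LEAST i. ?Q i) = i"
    by (intro Least_equality) (auto intro: leI)
  moreover have "\<exists>i. ?Q i" using * by auto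
  ultimately show "S2 n k \<pi> = Some i"
    by (simp add: S2_def second_max_iff_lehmer)
qed

text \<open>Let \<open>m\<close> be the only earlier position with a larger value. If
  \<open>\<pi> i = n - 1\<close>, then \<open>m\<close> holds \<open>n\<close>, and both
  \<open>m\<close> and \<open>i\<close> beat every later position. Otherwise some value other than
  \<open>\<pi> m\<close> exceeds \<open>\<pi> i\<close>; it must come after \<open>i\<close>, and
  the first such position has code at most 1.\<close>

lemma second_max_value_iff:
  assumes \<pi>: "\<pi> permutes {1..n}" and i: "i \<in> {1..n}" and "lehmer \<pi> i = 1"
  shows "\<pi> i = n - 1 \<longleftrightarrow> (\<forall>j\<in>{i<..n}. lehmer \<pi> j \<ge> 2)"
proof -
  have inj: "\<pi> a = \<pi> b \<longleftrightarrow> a = b" for a b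
    using permutes_inj[OF \<pi>] by (auto dest: injD)
  have le: "\<pi> j \<in> {1..n}" if "j \<in> {1..n}" for j
    using that permutes_in_image[OF \<pi>] by blast
  obtain m where m: "{j. 1 \<le> j \<and> j < i \<and> \<pi> j > \<pi> i} = {m}"
    using assms(3) unfolding lehmer_def by (auto simp: card_1_singleton_iff)
  then have m': "1 \<le> m" "m < i" "\<pi> m > \<pi> i" by auto
  have \<pi>m: "\<pi> m \<le> n" using le[of m] m' i by simp
  show ?thesis
  proof
    assume \<pi>i: "\<pi> i = n - 1"
    show "\<forall>j\<in>{i<..n}. lehmer \<pi> j \<ge> 2"
    proof
      fix j assume j: "j \<in> {i<..n}"
      then have "\<pi> j \<le> n" "\<pi> j \<noteq> \<pi> m" "\<pi> j \<noteq> \<pi> i"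
        using le[of j] m' i by (auto simp: inj)
      then have "\<pi> j < \<pi> i" using \<pi>i \<pi>m m'(3) by linarith
      then have "{m, i} \<subseteq> {l. 1 \<le> l \<and> l < j \<and> \<pi> l > \<pi> j}"
        using m' i j by auto
      then have "card {m, i} \<le> lehmer \<pi> j"
        unfolding lehmer_def by (intro card_mono) (auto intro: finite_subset[of _ "{..<j}"])
      then show "lehmer \<pi> j \<ge> 2" using m' by simp
    qed
  next
    assume later: "\<forall>j\<in>{i<..n}. lehmer \<pi> j \<ge> 2"
    show "\<pi> i = n - 1"
    proof (rule ccontr)
      assume "\<pi> i \<noteq> n - 1"
      then have lt: "\<pi> i < n - 1" using \<pi>m m'(3) by linarith
      \<comment> \<open>Both \<open>n - 1\<close> and \<open>n\<close> exceed
        \<open>\<pi> i\<close>, and at least one of them differs from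
        \<open>\<pi> m\<close>.\<close>
      define v where "v = (if \<pi> m = n then n - 1 else n)"
      have v: "v \<in> {1..n}" "v \<noteq> \<pi> m" "v > \<pi> i"
        using lt \<pi>m by (auto simp: v_def)
      obtain q where q: "q \<in> {1..n}" "\<pi> q = v"
        using v(1) permutes_image[OF \<pi>] by (metis imageE)
      let ?Q = "\<lambda>p. i < p \<and> p \<le> n \<and> \<pi> p > \<pi> i"
      have "\<not> q < i"
      proof
        assume "q < i"
        then have "q \<in> {m}" using m q v(3) by auto
        then show False using q(2) v(2) by simp
      qed
      moreover have "q \<noteq> i" using q(2) v(3) by auto
      ultimately have Qq: "?Q q" using q v(3) by auto
      define p where "p = (LEAST p. ?Q p)"
      have p: "?Q p" unfolding p_def using Qq by (rule LeastI)
      \<comment> \<open>A position before \<open>p\<close> that beats \<open>\<pi> p\<close> also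
        beats \<open>\<pi> i\<close>. Minimality of \<open>p\<close> excludes those after
        \<open>i\<close>, and before \<open>i\<close> only \<open>m\<close> is left.\<close>
      have "{l. 1 \<le> l \<and> l < p \<and> \<pi> l > \<pi> p} \<subseteq> {m}"
      proof
        fix l assume l: "l \<in> {l. 1 \<le> l \<and> l < p \<and> \<pi> l > \<pi> p}"
        then have "\<not> ?Q l" unfolding p_def using not_less_Least[of l ?Q] by auto
        with l p have "l < i" by (cases l i rule: linorder_cases) auto
        with l p have "l \<in> {j. 1 \<le> j \<and> j < i \<and> \<pi> j > \<pi> i}" by auto
        then show "l \<in> {m}" by (simp only: m)
      qed
      then have "lehmer \<pi> p \<le> 1"
        unfolding lehmer_def using card_mono[of "{m}"] by fastforce
      moreover have "lehmer \<pi> p \<ge> 2" using later p by auto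
      ultimately show False by simp
    qed
  qed
qed

section \<open>Product formulas for \<open>T2\<close> and \<open>W2\<close>\<close>

lemma prod_split_at:
  fixes f :: "nat \<Rightarrow> 'a::comm_monoid_mult"
  assumes "k \<le> n"
  shows "(\<Prod>j=1..n. f j) = (\<Prod>j=1..k. f j) * (\<Prod>j\<in>{k<..n}. f j)"
proof -
  have "{1..n} = {1..k} \<union> {k<..n}" using assms by auto
  also have "(\<Prod>j\<in>\<dots>. f j) = (\<Prod>j=1..k. f j) * (\<Prod>j\<in>{k<..n}. f j)"
    by (rule prod.union_disjoint) auto
  finally show ?thesis .
qed

lemma T2_eq:
  assumes "1 \<le> k" "k \<le> n"
  shows "T2 \<theta> n k = P_fact \<theta> k * (\<Prod>j\<in>{k<..n}. 1 + \<theta>\<^sup>2 * P \<theta> (j - 2))"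
proof -
  \<comment> \<open>The first \<open>k\<close> codes are free and give the factors of
    \<open>P_fact \<theta> k\<close>; rejecting all later positions means that their codes avoid
    1.\<close>
  define A :: "nat \<Rightarrow> nat set" where "A = (\<lambda>j. if j \<le> k then UNIV else -{1})"
  have "{\<pi>. \<pi> permutes {1..n} \<and> \<not> pickable n k \<pi>}
      = {\<pi>. \<pi> permutes {1..n} \<and> (\<forall>i\<in>{1..n}. lehmer \<pi> i \<in> A i)}"
    by (auto simp: pickable_iff_lehmer A_def)
  then have "T2 \<theta> n k = (\<Prod>i=1..n. \<Sum>a\<in>A i \<inter> {..<i}. \<theta> ^ a)"
    unfolding T2_def by (simp only: sum_inv_count_lehmer_in)
  also have "\<dots> = (\<Prod>i=1..k. \<Sum>a\<in>A i \<inter> {..<i}. \<theta> ^ a) * (\<Prod>i\<in>{k<..n}. \<Sum>a\<in>A i \<inter> {..<i}. \<theta> ^ a)"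
    by (rule prod_split_at[OF assms(2)])
  also have "(\<Prod>i=1..k. \<Sum>a\<in>A i \<inter> {..<i}. \<theta> ^ a) = P_fact \<theta> k"
    unfolding P_fact_def by (intro prod.cong) (auto simp: A_def P_def)
  also have "(\<Prod>i\<in>{k<..n}. \<Sum>a\<in>A i \<inter> {..<i}. \<theta> ^ a)
      = (\<Prod>j\<in>{k<..n}. 1 + \<theta>\<^sup>2 * P \<theta> (j - 2))"
    using assms(1) by (intro prod.cong refl) (simp add: A_def sum_power_neq1[simplified])
  finally show ?thesis .
qed

text \<open>The \<open>i\<close>-th summand is the difference of two mixed products, with
  \<open>x\<close> up to \<open>i\<close> and \<open>y\<close> beyond, or with \<open>x\<close>
  before \<open>i\<close> and \<open>y\<close> from \<open>i\<close> on. Neighbouring summands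
  cancel.\<close>

lemma sum_prod_telescope:
  fixes x y :: "nat \<Rightarrow> 'a::comm_ring_1"
  assumes "k \<le> n"
  shows "(\<Sum>i\<in>{k<..n}. (\<Prod>j\<in>{k<..<i}. x j) * (x i - y i) * (\<Prod>j\<in>{i<..n}. y j))
       = (\<Prod>j\<in>{k<..n}. x j) - (\<Prod>j\<in>{k<..n}. y j)"
  using assms
proof (induction n rule: dec_induct)
  case base
  show ?case by simp
next
  case (step n)
  have ins: "{i<..Suc n} = insert (Suc n) {i<..n}" if "i \<le> n" for i
    using that by auto
  have open_eq: "{k<..<Suc n} = {k<..n}" by auto
  have "(\<Sum>i\<in>{k<..n}. (\<Prod>j\<in>{k<..<i}. x j) * (x i - y i) * (\<Prod>j\<in>{i<..Suc n}. y j))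
      = (\<Sum>i\<in>{k<..n}. (\<Prod>j\<in>{k<..<i}. x j) * (x i - y i) * (\<Prod>j\<in>{i<..n}. y j)) * y (Suc n)"
    unfolding sum_distrib_right by (intro sum.cong refl) (simp add: ins mult_ac)
  also have "\<dots> = ((\<Prod>j\<in>{k<..n}. x j) - (\<Prod>j\<in>{k<..n}. y j)) * y (Suc n)"
    by (simp only: step.IH)
  finally show ?case
    using step.hyps by (simp add: ins open_eq algebra_simps)
qed

lemma W2_eq:
  assumes "1 \<le> k" "k \<le> n"
  shows "W2 \<theta> n k = \<theta> * P_fact \<theta> k *
    ((\<Prod>j\<in>{k<..n}. 1 + \<theta>\<^sup>2 * P \<theta> (j - 2)) - (\<Prod>j\<in>{k<..n}. \<theta>\<^sup>2 * P \<theta> (j - 2)))"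
proof -
  \<comment> \<open>\<open>A i j\<close> holds the codes allowed at \<open>j\<close> when the win
    occurs at \<open>i\<close>: free up to \<open>k\<close>, not 1 before \<open>i\<close>, equal to
    1 at \<open>i\<close>, at least 2 afterwards.\<close>
  define A :: "nat \<Rightarrow> nat \<Rightarrow> nat set" where
    "A = (\<lambda>i j. if j \<le> k then UNIV else if j < i then -{1} else if j = i then {1} else {2..})"
  define S where
    "S = (\<lambda>i. {\<pi>. \<pi> permutes {1..n} \<and> (\<forall>j\<in>{1..n}. lehmer \<pi> j \<in> A i j)})"
  define x where "x = (\<lambda>j. 1 + \<theta>\<^sup>2 * P \<theta> (j - 2))"
  define y where "y = (\<lambda>j. \<theta>\<^sup>2 * P \<theta> (j - 2))"
  have S_iff: "\<pi> \<in> S i \<longleftrightarrow> \<pi> permutes {1..n} \<and> S2 n k \<pi> = Some i \<and> \<pi> i = n - 1"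
    if i: "i \<in> {k<..n}" for i \<pi>
  proof -
    have "(\<forall>j\<in>{1..n}. lehmer \<pi> j \<in> A i j) \<longleftrightarrow>
        lehmer \<pi> i = 1 \<and> (\<forall>j\<in>{k<..<i}. lehmer \<pi> j \<noteq> 1) \<and> (\<forall>j\<in>{i<..n}. lehmer \<pi> j \<ge> 2)"
      (is "?L \<longleftrightarrow> ?R")
    proof
      assume L: ?L
      have A: "lehmer \<pi> j \<in> A i j" if "k < j" "j \<le> n" for j using L that by auto
      have "lehmer \<pi> i = 1"
        using A[of i] i by (simp add: A_def)
      moreover have "lehmer \<pi> j \<noteq> 1" if "j \<in> {k<..<i}" for j
        using A[of j] i that by (simp add: A_def)
      moreover have "lehmer \<pi> j \<ge> 2" if "j \<in> {i<..n}" for j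
        using A[of j] i that by (simp add: A_def)
      ultimately show ?R by blast
    next
      assume ?R
      then show ?L using i by (auto simp: A_def)
    qed
    then show ?thesis
      using second_max_value_iff[of \<pi> n i] i by (auto simp: S_def S2_eq_Some_iff)
  qed
  have fin: "finite (S i)" for i
    by (rule finite_subset[OF _ finite_permutations[of "{1..n}"]]) (auto simp: S_def)
  have "{\<pi>. \<pi> permutes {1..n} \<and> winnable n k \<pi>} = (\<Union>i\<in>{k<..n}. S i)"
  proof (rule set_eqI)
    fix \<pi>
    have "winnable n k \<pi> \<longleftrightarrow> (\<exists>i\<in>{k<..n}. S2 n k \<pi> = Some i \<and> \<pi> i = n - 1)"
      unfolding winnable_def by (auto simp: S2_eq_Some_iff)
    then show "\<pi> \<in> {\<pi>. \<pi> permutes {1..n} \<and> winnable n k \<pi>} \<longleftrightarrow> \<pi> \<in> (\<Union>i\<in>{k<..n}. S i)"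
      by (auto simp: S_iff)
  qed
  then have "W2 \<theta> n k = (\<Sum>\<pi>\<in>(\<Union>i\<in>{k<..n}. S i). \<theta> ^ inv_count n \<pi>)"
    unfolding W2_def by (simp only:)
  also have "\<dots> = (\<Sum>i\<in>{k<..n}. \<Sum>\<pi>\<in>S i. \<theta> ^ inv_count n \<pi>)"
    \<comment> \<open>The sets are disjoint because \<open>S2\<close> selects at most one
      position.\<close>
    using fin by (intro sum.UNION_disjoint) (auto simp: S_iff)
  also have "\<dots> = (\<Sum>i\<in>{k<..n}. \<theta> * P_fact \<theta> k *
      ((\<Prod>j\<in>{k<..<i}. x j) * (x i - y i) * (\<Prod>j\<in>{i<..n}. y j)))"
  proof (rule sum.cong[OF refl])
    fix i assume i: "i \<in> {k<..n}"
    let ?F = "\<lambda>j. \<Sum>a\<in>A i j \<inter> {..<j}. \<theta> ^ a"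
    have "(\<Sum>\<pi>\<in>S i. \<theta> ^ inv_count n \<pi>) = (\<Prod>j=1..n. ?F j)"
      unfolding S_def by (rule sum_inv_count_lehmer_in)
    also have "\<dots> = (\<Prod>j=1..k. ?F j) * (\<Prod>j\<in>{k<..n}. ?F j)"
      by (rule prod_split_at[OF assms(2)])
    also have "(\<Prod>j=1..k. ?F j) = P_fact \<theta> k"
      unfolding P_fact_def by (intro prod.cong) (auto simp: A_def P_def)
    also have "{k<..n} = {k<..<i} \<union> insert i {i<..n}" using i by auto
    also have "(\<Prod>j\<in>\<dots>. ?F j) = (\<Prod>j\<in>{k<..<i}. ?F j) * (?F i * (\<Prod>j\<in>{i<..n}. ?F j))"
      by (subst prod.union_disjoint) auto
    also have "(\<Prod>j\<in>{k<..<i}. ?F j) = (\<Prod>j\<in>{k<..<i}. x j)"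
      using assms(1) by (intro prod.cong refl) (simp add: A_def x_def sum_power_neq1[simplified])
    also have "(\<Prod>j\<in>{i<..n}. ?F j) = (\<Prod>j\<in>{i<..n}. y j)"
      using assms(1) i by (intro prod.cong refl) (simp add: A_def y_def sum_power_ge2)
    also have "?F i = \<theta>" using i assms(1) by (simp add: A_def)
    finally show "(\<Sum>\<pi>\<in>S i. \<theta> ^ inv_count n \<pi>) = \<theta> * P_fact \<theta> k *
        ((\<Prod>j\<in>{k<..<i}. x j) * (x i - y i) * (\<Prod>j\<in>{i<..n}. y j))"
      \<comment> \<open>The factor \<open>x i - y i\<close> equals 1; it is inserted to match the
        telescoping sum. The single \<theta> is the weight of the code 1 at
        \<open>i\<close>.\<close>
      by (simp add: x_def y_def mult_ac)
  qed
  also have "\<dots> = \<theta> * P_fact \<theta> k * ((\<Prod>j\<in>{k<..n}. x j) - (\<Prod>j\<in>{k<..n}. y j))"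
    by (simp only: sum_distrib_left[symmetric] sum_prod_telescope[OF assms(2)])
  finally show ?thesis by (simp only: x_def y_def)
qed

section \<open>Passing to the stated form\<close>

lemma prod_shift2:
  fixes f :: "nat \<Rightarrow> 'a::comm_monoid_mult"
  assumes "1 \<le> k" "k < n"
  shows "(\<Prod>j\<in>{k<..n}. f (j - 2)) = (\<Prod>j=k-1..n-2. f j)"
  using assms by (intro prod.reindex_bij_witness[of _ "\<lambda>j. j + 2" "\<lambda>j. j - 2"]) auto

text \<open>For \<open>k = 1\<close> both sides vanish because of \<open>P\<^sub>0 = 0\<close>.\<close>

lemma P_fact_mult_prod_P:
  assumes "1 \<le> k" "k < n"
  shows "P_fact \<theta> k * (\<Prod>j=k-1..n-2. P \<theta> j) = P_fact \<theta> (n - 2) * P \<theta> k * P \<theta> (k - 1)"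
proof (cases "k = 1")
  case True
  then have "(\<Prod>j=k-1..n-2. P \<theta> j) = 0"
    by (intro prod_zero bexI[of _ 0]) (auto simp: P_def)
  with True show ?thesis by (simp add: P_def)
next
  case False
  \<comment> \<open>Splitting \<open>P \<theta> (k - 1)\<close> and \<open>P \<theta> k\<close> off
    \<open>P_fact \<theta> k\<close> leaves \<open>P_fact \<theta> l\<close>, which the product from
    \<open>k - 1\<close> completes to \<open>P_fact \<theta> (n - 2)\<close>.\<close>
  define l where "l = k - 2"
  with False assms have l: "k = l + 2" by simp
  have "P_fact \<theta> (n - 2) = P_fact \<theta> l * (\<Prod>j\<in>{l<..n-2}. P \<theta> j)"
    unfolding P_fact_def using assms l by (intro prod_split_at) simp
  moreover have "{l<..n-2} = {k-1..n-2}" using l by auto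
  moreover have "P_fact \<theta> k = P_fact \<theta> l * P \<theta> (k - 1) * P \<theta> k"
    unfolding P_fact_def using l by simp
  ultimately show ?thesis by (simp add: mult_ac)
qed

theorem theorem8:
  fixes \<theta> :: real and k N :: nat
  assumes "\<theta> > 0" and "k \<ge> 1" and "N \<ge> k + 1"
  shows "W2 \<theta> N k =
           \<theta> * T2 \<theta> N k
           - \<theta> ^ (2 * N - 2 * k + 1) * P_fact \<theta> (N - 2) * P \<theta> k * P \<theta> (k - 1)
       \<and> W2 \<theta> N k =
           \<theta> * P_fact \<theta> k *
             ((\<Prod>j = k - 1..N - 2. 1 + \<theta>\<^sup>2 * P \<theta> j)
              - \<theta> ^ (2 * N - 2 * k) * (\<Prod>j = k - 1..N - 2. P \<theta> j))"
proof -
  have k: "1 \<le> k" "k \<le> N" "k < N" using assms by auto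
  let ?X = "\<Prod>j = k - 1..N - 2. 1 + \<theta>\<^sup>2 * P \<theta> j" and ?Y = "\<Prod>j = k - 1..N - 2. P \<theta> j"
  have X: "(\<Prod>j\<in>{k<..N}. 1 + \<theta>\<^sup>2 * P \<theta> (j - 2)) = ?X"
    by (rule prod_shift2[OF k(1,3), of "\<lambda>j. 1 + \<theta>\<^sup>2 * P \<theta> j"])
  \<comment> \<open>Each of the \<open>N - k\<close> factors contributes
    \<open>\<theta>\<^sup>2\<close>; the outer \<theta> later raises the exponent by one.\<close>
  have Y: "(\<Prod>j\<in>{k<..N}. \<theta>\<^sup>2 * P \<theta> (j - 2)) = \<theta> ^ (2 * N - 2 * k) * ?Y"
    by (simp add: prod.distrib prod_shift2[OF k(1,3), of "P \<theta>"] power_mult[symmetric]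
        right_diff_distrib')
  have W: "W2 \<theta> N k = \<theta> * P_fact \<theta> k * (?X - \<theta> ^ (2 * N - 2 * k) * ?Y)"
    using W2_eq[OF k(1,2), of \<theta>] by (simp only: X Y)
  have T: "T2 \<theta> N k = P_fact \<theta> k * ?X"
    using T2_eq[OF k(1,2), of \<theta>] by (simp only: X)
  have "W2 \<theta> N k = \<theta> * T2 \<theta> N k - \<theta> ^ (2 * N - 2 * k + 1) * (P_fact \<theta> k * ?Y)"
    unfolding W T by (simp add: algebra_simps)
  then have "W2 \<theta> N k = \<theta> * T2 \<theta> N k
      - \<theta> ^ (2 * N - 2 * k + 1) * P_fact \<theta> (N - 2) * P \<theta> k * P \<theta> (k - 1)"
    by (simp only: P_fact_mult_prod_P[OF k(1,3)] mult.assoc)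
  with W show ?thesis by blast
qed

end
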